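(* Let $\mathcal{L}$ be a general linear system of quadrics in $\mathbb{P}^3$ (over $\mathbb{C}$) of affine dimension $4$ and of rank $4$. Then the Weddle locus $W(\mathcal{L})\subset\mathbb{P}^3$ splits as the union of $4$ planes.
   Context: We work over $\mathbb{C}$. Let $n\ge 1$ and let $[x_0:\dots:x_n]$ be homogeneous coordinates on $\mathbb{P}^n$. A linear system $\mathcal{L}$ of quadrics in $\mathbb{P}^n$ is (the projectivization of) a linear subspace of the space of quadratic forms in $x_0,\dots,x_n$; its (affine) dimension $\dim\mathcal{L}$ is the dimension of this vector subspace. Suppose $\dim\mathcal{L}\le n+1$ and let $Q_0,\dots,Q_n$ be generators of $\mathcal{L}$. The Weddle matrix of $\mathcal{L}$ is the $(n+1)\times(n+1)$ matrix of linear forms $\mathbf{W}_{\mathcal{L}}=\big[\partial Q_k/\partial x_i\big]_{i,k=0,\dots,n}$ ($i$ row index, $k$ column index), and the Weddle locus of $\mathcal{L}$ is $W(\mathcal{L})=\{P\in\mathbb{P}^n : \det\mathbf{W}_{\mathcal{L}}|_P=0\}$. The rank of $\mathcal{L}$ is the minimal $r$ such that there are linear forms $l_1,\dots,l_r$ in $x_0,\dots,x_n$ with $\mathcal{L}\subseteq\langle l_1^2,\dots,l_r^2\rangle$ (equivalently, the partially symmetric rank of the associated tensor). "General linear system of rank $r$": consider the parameter space of pairs $((l_1,\dots,l_r),A)$, where the $l_i$ are linear forms in $x_0,\dots,x_n$ and $A=(A_{ik})$ is an $r\times(n+1)$ complex matrix, to which one associates the system generated by $Q_k=\sum_{i=1}^r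 A_{ik}l_i^2$, $k=0,\dots,n$. A property holds for the general linear system of dimension $n+1$ and rank $r$ if there is a nonempty Zariski open subset of this parameter space such that the property holds for every system of dimension $n+1$ and rank $r$ arising from a point of that subset. *)

theory Defs
  imports "HOL-Analysis.Analysis" "HOL-Library.Function_Algebras"
begin

text \<open>
  Forms in the homogeneous coordinates are represented by the functions on \<open>complex ^ 'n\<close> they
  induce (over the complex numbers nothing is lost); the coordinates of \<open>P\<^sup>n\<close> are indexed by
  a finite type with \<open>CARD('n) = n + 1\<close>.
\<close>

type_synonym 'n form = "complex ^ 'n \<Rightarrow> complex"

global_interpretation form: vector_space "\<lambda>(c::complex) (f::'a \<Rightarrow> complex) x. c * f x"
  by unfold_locales (auto simp: fun_eq_iff algebra_simps)

definition linear_form :: "complex ^ 'n \<Rightarrow> 'n::finite form" where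
  "linear_form a = (\<lambda>x. \<Sum>j\<in>UNIV. a $ j * x $ j)"

definition partial_deriv :: "'n::finite \<Rightarrow> 'n form \<Rightarrow> 'n form" where
  "partial_deriv i f = (\<lambda>x. deriv (\<lambda>t. f (x + t *s axis i 1)) 0)"

text \<open>Points of projective space are the lines through the origin.\<close>

definition proj_space :: "(complex ^ 'n::finite) set set" where
  "proj_space = {vec.span {x} | x. x \<noteq> 0}"

definition proj_zeros :: "'n::finite form \<Rightarrow> (complex ^ 'n) set set" where
  "proj_zeros F = {P \<in> proj_space. \<forall>x\<in>P. F x = 0}"

definition hyperplanes :: "(complex ^ 'n::finite) set set set" where
  "hyperplanes = {proj_zeros (linear_form a) | a. a \<noteq> 0}"

definition generators :: "('n::finite \<Rightarrow> 'n form) \<Rightarrow> 'n form set \<Rightarrow> bool" where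
  "generators Q \<L> \<longleftrightarrow> form.span (range Q) = \<L>"

definition weddle_matrix :: "('n::finite \<Rightarrow> 'n form) \<Rightarrow> complex ^ 'n \<Rightarrow> complex ^ 'n ^ 'n" where
  "weddle_matrix Q x = (\<chi> i k. partial_deriv i (Q k) x)"

text \<open>
  The Weddle locus is a function of the generators here; changing the generators of a system
  changes the determinant by a nonzero factor at most.
\<close>

definition weddle_locus :: "('n::finite \<Rightarrow> 'n form) \<Rightarrow> (complex ^ 'n) set set" where
  "weddle_locus Q = proj_zeros (\<lambda>x. det (weddle_matrix Q x))"

definition system_rank :: "'n::finite form set \<Rightarrow> nat" where
  "system_rank \<L> =
     (LEAST r. \<exists>l :: nat \<Rightarrow> complex ^ 'n.
        \<L> \<subseteq> form.span ((\<lambda>i x. (linear_form (l i) x)\<^sup>2) ` {..<r}))"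

text \<open>
  Parameters \<open>(l, A)\<close>: row \<open>i\<close> of \<open>l\<close> holds the coefficients of the \<open>i\<close>-th linear form,
  and \<open>A\<close> is an \<open>r \<times> (n + 1)\<close> matrix, where \<open>r = CARD('r)\<close>.
\<close>

type_synonym ('n, 'r) params = "(complex ^ 'n ^ 'r) \<times> (complex ^ 'n ^ 'r)"

definition param_system :: "('n::finite, 'r::finite) params \<Rightarrow> 'n form set" where
  "param_system p =
     form.span (range (\<lambda>k x. \<Sum>i\<in>UNIV. snd p $ i $ k * (linear_form (fst p $ i) x)\<^sup>2))"

inductive param_polynomial :: "(('n::finite, 'r::finite) params \<Rightarrow> complex) \<Rightarrow> bool" where
  "param_polynomial (\<lambda>_. c)"
| "param_polynomial (\<lambda>p. fst p $ i $ j)"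
| "param_polynomial (\<lambda>p. snd p $ i $ k)"
| "param_polynomial f \<Longrightarrow> param_polynomial g \<Longrightarrow> param_polynomial (\<lambda>p. f p + g p)"
| "param_polynomial f \<Longrightarrow> param_polynomial g \<Longrightarrow> param_polynomial (\<lambda>p. f p * g p)"

definition zariski_open :: "('n::finite, 'r::finite) params set \<Rightarrow> bool" where
  "zariski_open U \<longleftrightarrow>
     (\<exists>F. (\<forall>f\<in>F. param_polynomial f) \<and> U = {p. \<exists>f\<in>F. f p \<noteq> 0})"

text \<open>
  The type argument only fixes the rank \<open>CARD('r)\<close>; the dimension \<open>CARD('n)\<close> is the number
  of coordinates.
\<close>

definition general_system :: "'r::finite itself \<Rightarrow> ('n::finite form set \<Rightarrow> bool) \<Rightarrow> bool" where
  "general_system _ prop \<longleftrightarrow>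
     (\<exists>U :: ('n, 'r) params set. zariski_open U \<and> U \<noteq> {} \<and>
        (\<forall>p\<in>U. form.dim (param_system p) = CARD('n) \<and> system_rank (param_system p) = CARD('r)
           \<longrightarrow> prop (param_system p)))"

end

theory Submission imports Defs begin

text \<open>
  For \<open>Q\<^sub>k = \<Sum>\<^sub>m B\<^sub>m\<^sub>k l\<^sub>m\<^sup>2\<close> the Weddle matrix factors as \<open>L\<^sup>T diag(2 l\<^sub>m) B\<close>, with \<open>L\<close> the coefficient
  matrix of the \<open>l\<^sub>m\<close>, so its determinant is a multiple of \<open>\<Prod>\<^sub>m l\<^sub>m\<close>. On the open set
  \<open>det L \<cdot> det A \<noteq> 0\<close> the constant is nonzero for every choice of generators, because the
  squares \<open>l\<^sub>m\<^sup>2\<close> are linearly independent, as one sees by evaluating at the dual basis; the locus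
  is then the union of the distinct hyperplanes \<open>l\<^sub>m = 0\<close>.
\<close>

lemma sum_fun_apply: "(\<Sum>i\<in>I. f i) x = (\<Sum>i\<in>I. f i x)"
  for f :: "'i \<Rightarrow> 'a \<Rightarrow> 'b::comm_monoid_add"
  by (induction I rule: infinite_finite_induct) auto

text \<open>Coefficients are indexed by \<open>'i\<close> and not by elements of
  \<open>range g\<close>, so repeated members of the family are harmless and coefficients can be
  assembled into matrices.\<close>

lemma form_in_span_range_iff:
  fixes g :: "'i::finite \<Rightarrow> 'a \<Rightarrow> complex"
  shows "f \<in> form.span (range g) \<longleftrightarrow> (\<exists>c. f = (\<lambda>x. \<Sum>i\<in>UNIV. c i * g i x))"
proof
  assume "f \<in> form.span (range g)"
  then show "\<exists>c. f = (\<lambda>x. \<Sum>i\<in>UNIV. c i * g i x)"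
  proof (induction rule: form.span_induct_alt)
    case base
    show ?case by (rule exI[of _ "\<lambda>_. 0"]) (simp add: fun_eq_iff)
  next
    case (step a s y)
    then obtain j c where "s = g j" and "y = (\<lambda>x. \<Sum>i\<in>UNIV. c i * g i x)" by blast
    then have "(\<lambda>x. a * s x) + y = (\<lambda>x. \<Sum>i\<in>UNIV. (c i + (if i = j then a else 0)) * g i x)"
      by (simp add: fun_eq_iff distrib_right sum.distrib if_distrib[of "\<lambda>z. z * _"] cong: if_cong)
    then show ?case by (intro exI[of _ "\<lambda>i. c i + (if i = j then a else 0)"])
  qed
next
  assume "\<exists>c. f = (\<lambda>x. \<Sum>i\<in>UNIV. c i * g i x)"
  then obtain c where "f = (\<lambda>x. \<Sum>i\<in>UNIV. c i * g i x)" ..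
  then have "f = (\<Sum>i\<in>UNIV. (\<lambda>x. c i * g i x))"
    by (simp add: fun_eq_iff sum_fun_apply)
  also have "\<dots> \<in> form.span (range g)"
    by (intro form.span_sum form.span_scale form.span_base) simp
  finally show "f \<in> form.span (range g)" .
qed

lemma linear_form_row: "linear_form (L $ m) x = (L *v x) $ m"
  by (simp add: linear_form_def matrix_vector_mult_def)

lemma linear_form_scale: "linear_form a (c *s x) = c * linear_form a x"
  by (simp add: linear_form_def sum_distrib_left algebra_simps)

lemma linear_form_add_axis: "linear_form a (x + t *s axis i 1) = linear_form a x + t * a $ i"
  by (simp add: linear_form_def axis_def distrib_left sum.distrib if_distrib[of "\<lambda>z. _ * z"] cong: if_cong)

text \<open>By homogeneity, vanishing at one spanning vector passes to the whole line.\<close>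

lemma in_proj_zeros_linear_form:
  assumes "x \<noteq> 0"
  shows "vec.span {x} \<in> proj_zeros (linear_form a) \<longleftrightarrow> linear_form a x = 0"
  using assms
  by (auto simp: proj_zeros_def proj_space_def vec.span_singleton linear_form_scale
      intro: vec.span_base)

lemma proj_zeros_prod_linear_forms:
  assumes "\<And>x. F x = c * (\<Prod>m\<in>UNIV. linear_form (L $ m) x)" and "c \<noteq> 0"
  shows "proj_zeros F = (\<Union>m::'m::finite. proj_zeros (linear_form (L $ m)))"
proof (intro set_eqI iffI)
  fix P assume P: "P \<in> proj_zeros F"
  then obtain x where x: "P = vec.span {x}" "x \<noteq> 0"
    by (auto simp: proj_zeros_def proj_space_def)
  have "F x = 0" using P x by (auto simp: proj_zeros_def intro: vec.span_base)
  then obtain m where "linear_form (L $ m) x = 0" using assms by auto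
  then show "P \<in> (\<Union>m. proj_zeros (linear_form (L $ m)))"
    using x in_proj_zeros_linear_form by blast
next
  fix P assume "P \<in> (\<Union>m. proj_zeros (linear_form (L $ m)))"
  then show "P \<in> proj_zeros F"
    using assms by (auto simp: proj_zeros_def)
qed

text \<open>Chain rule, the m-th linear form having slope \<open>L $ m $ i\<close> along the i-th
  axis. The factors are ordered as in an entry of the product of \<open>transpose L\<close>, a
  diagonal matrix and a coefficient matrix.\<close>

lemma partial_deriv_sum_squares:
  "partial_deriv i (\<lambda>x. \<Sum>m\<in>UNIV. b m * (linear_form (L $ m) x)\<^sup>2) x =
     (\<Sum>m\<in>(UNIV::'m::finite set). L $ m $ i * (2 * linear_form (L $ m) x) * b m)"
  unfolding partial_deriv_def linear_form_add_axis
  by (rule DERIV_imp_deriv)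
    (auto intro!: derivative_eq_intros sum.cong simp: algebra_simps)

lemma det_weddle_matrix_sum_squares:
  fixes B L :: "complex ^ 'n ^ 'n"
  assumes Q: "\<And>k. Q k = (\<lambda>x. \<Sum>m\<in>UNIV. B $ m $ k * (linear_form (L $ m) x)\<^sup>2)"
  shows "det (weddle_matrix Q x) =
    det L * 2 ^ CARD('n) * det B * (\<Prod>m\<in>UNIV. linear_form (L $ m) x)"
proof -
  define D :: "complex ^ 'n ^ 'n"
    where "D = (\<chi> i j. if i = j then 2 * linear_form (L $ i) x else 0)"
  have "weddle_matrix Q x = transpose L ** D ** B"
    by (simp add: weddle_matrix_def Q partial_deriv_sum_squares matrix_matrix_mult_def
        transpose_def D_def vec_eq_iff if_distrib cong: if_cong)
  moreover have "det D = 2 ^ CARD('n) * (\<Prod>m\<in>UNIV. linear_form (L $ m) x)"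
    by (subst det_diagonal) (auto simp: D_def prod.distrib)
  ultimately show ?thesis by (simp add: det_mul)
qed

text \<open>The columns of the inverse of \<open>L\<close> serve as the \<open>y j\<close>.\<close>

lemma dual_basis_exists:
  fixes L :: "complex ^ 'n ^ 'n"
  assumes "det L \<noteq> 0"
  obtains y where "\<And>j m. linear_form (L $ m) (y j) = (if m = j then 1 else 0)"
proof -
  obtain M where "L ** M = mat 1"
    using assms by (auto simp: invertible_det_nz[symmetric] invertible_def)
  then have "L *v (M *v axis j 1) = axis j 1" for j
    by (simp add: matrix_vector_mul_assoc)
  then have "linear_form (L $ m) (M *v axis j 1) = (if m = j then 1 else 0)" for j m
    by (simp add: linear_form_row axis_def)
  then show thesis by (rule that)
qed

text \<open>\<open>Q\<close> is any generating family, not only the one that \<open>A\<close>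
  prescribes. Since \<open>det A\<close> is nonzero, \<open>Q\<close> and the squares span the same
  space; the two expansions, of \<open>Q\<close> in squares and of squares in \<open>Q\<close>, give
  \<open>B\<close> and a right inverse of it.\<close>

lemma generators_det_nonzero:
  fixes L A :: "complex ^ 'n ^ 'n"
  assumes L: "det L \<noteq> 0" and A: "det A \<noteq> 0" and gen: "generators Q (param_system (L, A))"
  obtains B where "det B \<noteq> 0"
    and "\<And>k. Q k = (\<lambda>x. \<Sum>m\<in>UNIV. B $ m $ k * (linear_form (L $ m) x)\<^sup>2)"
proof -
  define P where "P = (\<lambda>k x. \<Sum>i\<in>UNIV. A $ i $ k * (linear_form (L $ i) x)\<^sup>2)"
  define S where "S = (\<lambda>m x. (linear_form (L $ m) x)\<^sup>2)"
  have span: "form.span (range Q) = form.span (range P)"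
    using gen by (simp add: generators_def param_system_def P_def)
  have "P k \<in> form.span (range S)" for k
    by (auto simp: form_in_span_range_iff P_def S_def)
  then have "form.span (range P) \<subseteq> form.span (range S)"
    by (intro form.span_minimal) auto
  then have "Q k \<in> form.span (range S)" for k
    using span form.span_base[of "Q k" "range Q"] by auto
  then have "\<exists>b. Q k = (\<lambda>x. \<Sum>m\<in>UNIV. b m * S m x)" for k
    by (simp add: form_in_span_range_iff)
  then obtain b where b: "\<And>k. Q k = (\<lambda>x. \<Sum>m\<in>UNIV. b k m * S m x)" by metis
  define B :: "complex ^ 'n ^ 'n" where "B = (\<chi> m k. b k m)"
  obtain A' where A': "A ** A' = mat 1"
    using A by (auto simp: invertible_det_nz[symmetric] invertible_def)
  \<comment> \<open>Inverting \<open>A\<close> recovers each square from the prescribed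
    generators.\<close>
  have "S j = (\<lambda>x. \<Sum>k\<in>UNIV. A' $ k $ j * P k x)" for j
  proof
    fix x
    have "(\<Sum>k\<in>UNIV. A' $ k $ j * P k x) = (\<Sum>k\<in>UNIV. \<Sum>i\<in>UNIV. A $ i $ k * A' $ k $ j * S i x)"
      by (simp add: P_def S_def sum_distrib_left algebra_simps)
    also have "\<dots> = (\<Sum>i\<in>UNIV. (A ** A') $ i $ j * S i x)"
      by (subst sum.swap) (simp add: matrix_matrix_mult_def sum_distrib_right)
    also have "\<dots> = S j x"
      by (simp add: A' mat_def if_distrib[of "\<lambda>z. z * _"] cong: if_cong)
    finally show "S j x = (\<Sum>k\<in>UNIV. A' $ k $ j * P k x)" ..
  qed
  then have "S j \<in> form.span (range Q)" for j
    unfolding span form_in_span_range_iff by (intro exI[of _ "\<lambda>k. A' $ k $ j"])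
  then have "\<exists>c. S j = (\<lambda>x. \<Sum>k\<in>UNIV. c k * Q k x)" for j
    by (simp add: form_in_span_range_iff)
  then obtain c where c: "\<And>j. S j = (\<lambda>x. \<Sum>k\<in>UNIV. c j k * Q k x)" by metis
  obtain y where y: "\<And>j m. linear_form (L $ m) (y j) = (if m = j then 1 else 0)"
    using dual_basis_exists[OF L] by blast
  have Sy: "S m (y j) = (if m = j then 1 else 0)" for m j
    by (simp add: S_def y)
  have Qy: "Q k (y i) = B $ i $ k" for k i
    by (simp add: b Sy B_def if_distrib cong: if_cong)
  have "B ** (\<chi> k j. c j k) = mat 1"
  proof -
    \<comment> \<open>Evaluating the expansion of \<open>S j\<close> at \<open>y i\<close> gives the
      entry (i, j) of the product.\<close>
    have "(\<Sum>k\<in>UNIV. B $ i $ k * c j k) = (if i = j then 1 else 0)" for i j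
      using fun_cong[OF c, of j "y i"] by (auto simp: Qy Sy mult.commute)
    then show ?thesis by (simp add: matrix_matrix_mult_def mat_def vec_eq_iff)
  qed
  then have "det B * det (\<chi> k j. c j k) = 1"
    by (metis det_mul det_I)
  then have "det B \<noteq> 0" by auto
  then show thesis by (rule that) (simp add: b B_def S_def)
qed

text \<open>The choice of \<open>Q\<close> affects the determinant only through the nonzero constant
  \<open>det B\<close>, so the hyperplanes depend on \<open>L\<close> alone.\<close>

lemma weddle_locus_eq_Union_hyperplanes:
  fixes L A :: "complex ^ 'n ^ 'n"
  assumes "det L \<noteq> 0" "det A \<noteq> 0" "generators Q (param_system (L, A))"
  shows "weddle_locus Q = (\<Union>m. proj_zeros (linear_form (L $ m)))"
proof -
  obtain B where "det B \<noteq> 0"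
    and "\<And>k. Q k = (\<lambda>x. \<Sum>m\<in>UNIV. B $ m $ k * (linear_form (L $ m) x)\<^sup>2)"
    using generators_det_nonzero[OF assms] by blast
  then show ?thesis
    unfolding weddle_locus_def using assms(1)
    by (intro proj_zeros_prod_linear_forms[where c = "det L * 2 ^ CARD('n) * det B"]
        det_weddle_matrix_sum_squares) auto
qed

text \<open>The point spanned by the dual vector \<open>y j\<close> lies on every one of these
  hyperplanes except the j-th, which tells them apart.\<close>

lemma inj_proj_zeros_rows:
  fixes L :: "complex ^ 'n ^ 'n"
  assumes "det L \<noteq> 0"
  shows "inj (\<lambda>m. proj_zeros (linear_form (L $ m)))"
proof
  obtain y where y: "\<And>j m. linear_form (L $ m) (y j) = (if m = j then 1 else 0)"
    using dual_basis_exists[OF assms] by blast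
  have "y j \<noteq> 0" for j
    using y[of j j] by (auto simp: linear_form_def)
  then have iff: "vec.span {y j} \<in> proj_zeros (linear_form (L $ m)) \<longleftrightarrow> m \<noteq> j" for j m
    by (simp add: in_proj_zeros_linear_form y)
  show "m = j" if "proj_zeros (linear_form (L $ m)) = proj_zeros (linear_form (L $ j))" for m j
    using iff[of j m] iff[of j j] that by auto
qed

lemma param_polynomial_sum:
  assumes "\<And>s. s \<in> S \<Longrightarrow> param_polynomial (f s)"
  shows "param_polynomial (\<lambda>p. \<Sum>s\<in>S. f s p)"
  using assms
  by (induction S rule: infinite_finite_induct) (auto intro: param_polynomial.intros)

lemma param_polynomial_prod:
  assumes "\<And>s. s \<in> S \<Longrightarrow> param_polynomial (f s)"
  shows "param_polynomial (\<lambda>p. \<Prod>s\<in>S. f s p)"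
  using assms
  by (induction S rule: infinite_finite_induct) (auto intro: param_polynomial.intros)

text \<open>By the Leibniz formula, a determinant is a sum of constant signs times products of
  entries.\<close>

lemma param_polynomial_det:
  assumes "\<And>i j. param_polynomial (\<lambda>p. M p $ i $ j)"
  shows "param_polynomial (\<lambda>p. det (M p :: complex ^ 'm ^ 'm))"
  unfolding det_def
  by (intro param_polynomial_sum param_polynomial.intros param_polynomial_prod assms)

lemma zariski_open_nonzero:
  assumes "param_polynomial f"
  shows "zariski_open {p. f p \<noteq> 0}"
  unfolding zariski_open_def using assms by (intro exI[of _ "{f}"]) auto

text \<open>When the rank equals the number of coordinates, \<open>L\<close> and \<open>A\<close>
  are square and their determinants cut out the open set. The family of hyperplanes is chosen before
  \<open>Q\<close>, hence is common to all generators.\<close>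

lemma general_system_full_rank:
  "general_system TYPE('n::finite)
     (\<lambda>\<L> :: 'n form set.
        \<exists>\<H>. \<H> \<subseteq> hyperplanes \<and> card \<H> = CARD('n) \<and>
            (\<forall>Q. generators Q \<L> \<longrightarrow> weddle_locus Q = \<Union>\<H>))"
  unfolding general_system_def
proof (intro exI[of _ "{p. det (fst p) * det (snd p) \<noteq> 0}"] conjI ballI impI)
  show "zariski_open {p :: ('n, 'n) params. det (fst p) * det (snd p) \<noteq> 0}"
    by (intro zariski_open_nonzero param_polynomial.intros param_polynomial_det)
  \<comment> \<open>This parameter gives the system spanned by the squares of the
    coordinates.\<close>
  have "(mat 1, mat 1) \<in> {p :: ('n, 'n) params. det (fst p) * det (snd p) \<noteq> 0}" by simp
  then show "{p :: ('n, 'n) params. det (fst p) * det (snd p) \<noteq> 0} \<noteq> {}" by blast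
next
  fix p :: "('n, 'n) params"
  assume "p \<in> {p. det (fst p) * det (snd p) \<noteq> 0}"
  then obtain L A where p: "p = (L, A)" and L: "det L \<noteq> 0" and A: "det A \<noteq> 0"
    by (cases p) auto
  let ?H = "range (\<lambda>m. proj_zeros (linear_form (L $ m)))"
  \<comment> \<open>A zero row would make \<open>det L\<close> vanish; \<open>hyperplanes\<close>
    admits only nonzero coefficient vectors.\<close>
  have "L $ m \<noteq> 0" for m
    using L det_zero_row(2)[of m L] by (auto simp: row_def vec_eq_iff)
  then have "?H \<subseteq> hyperplanes" by (auto simp: hyperplanes_def)
  moreover have "card ?H = CARD('n)"
    by (rule card_image[OF inj_proj_zeros_rows[OF L]])
  moreover have "weddle_locus Q = \<Union>?H" if "generators Q (param_system p)" for Q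
    using weddle_locus_eq_Union_hyperplanes[OF L A] that p by blast
  ultimately show "\<exists>\<H>. \<H> \<subseteq> hyperplanes \<and> card \<H> = CARD('n) \<and>
      (\<forall>Q. generators Q (param_system p) \<longrightarrow> weddle_locus Q = \<Union>\<H>)"
    by blast
qed

theorem proposition3p7:
  "general_system TYPE(4)
     (\<lambda>\<L> :: 4 form set.
        \<exists>\<H>. \<H> \<subseteq> hyperplanes \<and> card \<H> = 4 \<and>
            (\<forall>Q. generators Q \<L> \<longrightarrow> weddle_locus Q = \<Union>\<H>))"
  using general_system_full_rank[where 'n = 4] by simp

end
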